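(* Let $K$ be a totally disconnected compact group and $\psi:K\to K$ a topological automorphism such that the pair $(K,\psi)$ has finite depth. Then $$h_{top}(\psi)=\log\operatorname{depth}(\psi).$$
   Context: A topological automorphism is a group automorphism that is also a homeomorphism. $\mathcal B(K)$ is the family of all open subgroups of $K$. A subgroup $U\in\mathcal B(K)$ is $\psi$-antistable if $\bigcap_{n\in\mathbb Z}\psi^n(U)=\{1\}$; the pair $(K,\psi)$ has finite depth if there exists a $\psi$-antistable $U\in\mathcal B(K)$. For $U\in\mathcal B(K)$ and a positive integer $n$, $C_n(\psi,U)=U\cap\psi^{-1}(U)\cap\ldots\cap\psi^{-n+1}(U)$, and $U_+=C(\psi^{-1},U)=\bigcap_{n=0}^\infty\psi^n(U)$. For a pair $(K,\psi)$ of finite depth, the depth of $\psi$ is $\operatorname{depth}(\psi)=[\psi(U_+):U_+]$, where $U\in\mathcal B(K)$ is any $\psi$-antistable subgroup; this index is finite and does not depend on the choice of the $\psi$-antistable $U$ (a known result of Willis). The topological entropy of $\psi$ with respect to $U\in\mathcal B(K)$ is the limit (which exists) $H_{top}(\psi,U)=\lim_{n\to\infty}\frac{\log[K:C_n(\psi,U)]}{n}$, and the topological entropy of $\psi$ is $h_{top}(\psi)=\sup\{H_{top}(\psi,U):U\in\mathcal B(K)\}$. *)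

theory Defs
  imports "HOL-Analysis.Analysis" "HOL-Algebra.Coset"
begin

(* No separation axiom is included; for a totally disconnected group the Hausdorff property
   is automatic. *)
definition topological_group :: "('a, 'b) monoid_scheme \<Rightarrow> 'a topology \<Rightarrow> bool" where
  "topological_group K T \<longleftrightarrow>
     group K \<and> topspace T = carrier K \<and>
     continuous_map (prod_topology T T) T (\<lambda>(x, y). x \<otimes>\<^bsub>K\<^esub> y) \<and>
     continuous_map T T (\<lambda>x. inv\<^bsub>K\<^esub> x)"

definition totally_disconnected_space :: "'a topology \<Rightarrow> bool" where
  "totally_disconnected_space T \<longleftrightarrow>
     (\<forall>x\<in>topspace T. connected_component_of_set T x = {x})"

definition topological_automorphism ::
    "('a, 'b) monoid_scheme \<Rightarrow> 'a topology \<Rightarrow> ('a \<Rightarrow> 'a) \<Rightarrow> bool" where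
  "topological_automorphism K T \<psi> \<longleftrightarrow> \<psi> \<in> iso K K \<and> homeomorphic_map T T \<psi>"

definition open_subgroups :: "('a, 'b) monoid_scheme \<Rightarrow> 'a topology \<Rightarrow> 'a set set" where
  "open_subgroups K T = {U. subgroup U K \<and> openin T U}"

(* The index [H : L] for a subgroup L contained in H, as a natural number. As usual for card,
   an infinite index would give 0; the lemmas below show that the indices used here
   are finite. *)
definition subgroup_index :: "('a, 'b) monoid_scheme \<Rightarrow> 'a set \<Rightarrow> 'a set \<Rightarrow> nat" where
  "subgroup_index K H L = card (rcosets\<^bsub>K\<lparr>carrier := H\<rparr>\<^esub> L)"

(* Only the values on carrier K matter, so the inverse of \<psi> is taken relative to carrier K. *)
definition aut_power :: "('a, 'b) monoid_scheme \<Rightarrow> ('a \<Rightarrow> 'a) \<Rightarrow> int \<Rightarrow> 'a \<Rightarrow> 'a" where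
  "aut_power K \<psi> n =
     (if 0 \<le> n then \<psi> ^^ nat n else inv_into (carrier K) \<psi> ^^ nat (- n))"

definition antistable :: "('a, 'b) monoid_scheme \<Rightarrow> ('a \<Rightarrow> 'a) \<Rightarrow> 'a set \<Rightarrow> bool" where
  "antistable K \<psi> U \<longleftrightarrow> (\<Inter>n::int. aut_power K \<psi> n ` U) = {\<one>\<^bsub>K\<^esub>}"

definition finite_depth ::
    "('a, 'b) monoid_scheme \<Rightarrow> 'a topology \<Rightarrow> ('a \<Rightarrow> 'a) \<Rightarrow> bool" where
  "finite_depth K T \<psi> \<longleftrightarrow> (\<exists>U\<in>open_subgroups K T. antistable K \<psi> U)"

(* C_n(\<psi>, U), meaningful for positive n only. *)
definition cotrajectory ::
    "('a, 'b) monoid_scheme \<Rightarrow> ('a \<Rightarrow> 'a) \<Rightarrow> nat \<Rightarrow> 'a set \<Rightarrow> 'a set" where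
  "cotrajectory K \<psi> n U = (\<Inter>k<n. aut_power K \<psi> (- int k) ` U)"

(* U_+ *)
definition plus_part :: "('a, 'b) monoid_scheme \<Rightarrow> ('a \<Rightarrow> 'a) \<Rightarrow> 'a set \<Rightarrow> 'a set" where
  "plus_part K \<psi> U = (\<Inter>n::nat. aut_power K \<psi> (int n) ` U)"

(* The common value of [\<psi>(U_+) : U_+] over all antistable open subgroups U. *)
definition depth :: "('a, 'b) monoid_scheme \<Rightarrow> 'a topology \<Rightarrow> ('a \<Rightarrow> 'a) \<Rightarrow> nat" where
  "depth K T \<psi> =
     (THE d. \<forall>U\<in>open_subgroups K T. antistable K \<psi> U \<longrightarrow>
        subgroup_index K (\<psi> ` plus_part K \<psi> U) (plus_part K \<psi> U) = d)"

definition H_top :: "('a, 'b) monoid_scheme \<Rightarrow> ('a \<Rightarrow> 'a) \<Rightarrow> 'a set \<Rightarrow> real" where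
  "H_top K \<psi> U =
     lim (\<lambda>n. ln (real (subgroup_index K (carrier K) (cotrajectory K \<psi> n U))) / real n)"

(* The supremum is taken in the extended reals, so it needs no boundedness assumption. *)
definition h_top :: "('a, 'b) monoid_scheme \<Rightarrow> 'a topology \<Rightarrow> ('a \<Rightarrow> 'a) \<Rightarrow> ereal" where
  "h_top K T \<psi> = (SUP U\<in>open_subgroups K T. ereal (H_top K \<psi> U))"

lemma finite_rcosets_open_subgroup:
  assumes "topological_group K T" "compact_space T" "U \<in> open_subgroups K T"
  shows "finite (rcosets\<^bsub>K\<^esub> U)"
proof -
  interpret group K using assms(1) by (simp add: topological_group_def)
  have TK: "topspace T = carrier K" using assms(1) by (simp add: topological_group_def)
  have sub: "subgroup U K" and op: "openin T U"
    using assms(3) by (auto simp: open_subgroups_def)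
  have UK: "U \<subseteq> carrier K" using sub by (rule subgroup.subset)
  have opc: "openin T C" if C: "C \<in> rcosets\<^bsub>K\<^esub> U" for C
  proof -
    obtain a where a: "a \<in> carrier K" "C = U #>\<^bsub>K\<^esub> a"
      using C by (auto simp: RCOSETS_def)
    have "continuous_map T (prod_topology T T) (\<lambda>x. (x, inv\<^bsub>K\<^esub> a))"
      using a TK by (intro continuous_map_pairedI) auto
    moreover have "continuous_map (prod_topology T T) T (\<lambda>(x, y). x \<otimes>\<^bsub>K\<^esub> y)"
      using assms(1) by (simp add: topological_group_def)
    ultimately have "continuous_map T T ((\<lambda>(x, y). x \<otimes>\<^bsub>K\<^esub> y) \<circ> (\<lambda>x. (x, inv\<^bsub>K\<^esub> a)))"
      by (rule continuous_map_compose)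
    then have "openin T {x \<in> topspace T. ((\<lambda>(x, y). x \<otimes>\<^bsub>K\<^esub> y) \<circ> (\<lambda>x. (x, inv\<^bsub>K\<^esub> a))) x \<in> U}"
      using op by (rule openin_continuous_map_preimage)
    moreover have "{x \<in> topspace T. ((\<lambda>(x, y). x \<otimes>\<^bsub>K\<^esub> y) \<circ> (\<lambda>x. (x, inv\<^bsub>K\<^esub> a))) x \<in> U} = C"
      using a UK TK by (force simp: r_coset_def m_assoc inv_solve_right)
    ultimately show ?thesis by simp
  qed
  have cov: "\<Union>(rcosets\<^bsub>K\<^esub> U) = topspace T"
    using rcosets_part_G[OF sub] TK by simp
  obtain F where F: "finite F" "F \<subseteq> rcosets\<^bsub>K\<^esub> U" "topspace T \<subseteq> \<Union>F"
    using assms(2) opc cov unfolding compact_space_alt by (metis order_refl)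
  have "rcosets\<^bsub>K\<^esub> U \<subseteq> F"
  proof
    fix C assume C: "C \<in> rcosets\<^bsub>K\<^esub> U"
    have "C \<noteq> {}" using subgroup.rcosets_non_empty[OF sub C] .
    then obtain x where x: "x \<in> C" by blast
    then have "x \<in> topspace T" using C cov by blast
    then obtain D where D: "D \<in> F" "x \<in> D" using F(3) by blast
    have "C = D"
      using rcos_disjoint[OF sub] C D x F(2)
      unfolding pairwise_def disjnt_def by blast
    then show "C \<in> F" using D by simp
  qed
  then show ?thesis using F(1) finite_subset by blast
qed

lemma subgroup_index_carrier: "subgroup_index K (carrier K) L = card (rcosets\<^bsub>K\<^esub> L)"
  by (simp add: subgroup_index_def)

lemma aut_power_image_open_subgroup:
  assumes "topological_group K T" "topological_automorphism K T \<psi>" "U \<in> open_subgroups K T"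
  shows "aut_power K \<psi> n ` U \<in> open_subgroups K T"
proof -
  interpret group K using assms(1) by (simp add: topological_group_def)
  have TK: "topspace T = carrier K" using assms(1) by (simp add: topological_group_def)
  let ?i = "inv_into (carrier K) \<psi>"
  have iso: "\<psi> \<in> iso K K" and hm: "homeomorphic_map T T \<psi>"
    using assms(2) by (auto simp: topological_automorphism_def)
  have iso': "?i \<in> iso K K" using iso_set_sym[OF iso] .
  obtain g where g: "homeomorphic_maps T T \<psi> g"
    using hm by (auto simp: homeomorphic_map_maps)
  have geq: "g x = ?i x" if "x \<in> topspace T" for x
    using g that TK iso unfolding homeomorphic_maps_def iso_def bij_betw_def continuous_map_def
    by (metis (no_types, lifting) PiE inv_into_f_f mem_Collect_eq)
  have hm': "homeomorphic_map T T ?i"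
  proof -
    have "homeomorphic_map T T g" using g homeomorphic_map_maps homeomorphic_maps_sym by blast
    then show ?thesis using homeomorphic_map_eq geq by metis
  qed
  have step: "f ` V \<in> open_subgroups K T"
    if "f \<in> iso K K" "homeomorphic_map T T f" "V \<in> open_subgroups K T" for f V
  proof -
    have "group_hom K K f"
      using that(1) by (simp add: group_hom_def group_hom_axioms_def iso_def is_group)
    then have "subgroup (f ` V) K"
      using that(3) by (simp add: open_subgroups_def group_hom.subgroup_img_is_subgroup)
    moreover have "openin T (f ` V)"
      using that homeomorphic_imp_open_map unfolding open_subgroups_def open_map_def by blast
    ultimately show ?thesis by (simp add: open_subgroups_def)
  qed
  have pw: "(f ^^ m) ` U \<in> open_subgroups K T"
    if "f \<in> iso K K" "homeomorphic_map T T f" for f m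
  proof (induction m)
    case 0
    then show ?case using assms(3) by simp
  next
    case (Suc m)
    then show ?case using step[OF that Suc] by (simp add: image_comp)
  qed
  show ?thesis
    using pw[OF iso hm] pw[OF iso' hm'] by (simp add: aut_power_def)
qed

lemma cotrajectory_open_subgroup:
  assumes "topological_group K T" "topological_automorphism K T \<psi>" "U \<in> open_subgroups K T" "n > 0"
  shows "cotrajectory K \<psi> n U \<in> open_subgroups K T"
proof -
  interpret group K using assms(1) by (simp add: topological_group_def)
  have o: "aut_power K \<psi> m ` U \<in> open_subgroups K T" for m
    by (rule aut_power_image_open_subgroup[OF assms(1-3)])
  have "subgroup (cotrajectory K \<psi> n U) K"
    unfolding cotrajectory_def using o assms(4)
    by (intro subgroups_Inter) (auto simp: open_subgroups_def)
  moreover have "openin T (cotrajectory K \<psi> n U)"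
    unfolding cotrajectory_def using o assms(4)
    by (intro openin_Inter) (auto simp: open_subgroups_def)
  ultimately show ?thesis by (simp add: open_subgroups_def)
qed

lemma finite_rcosets_cotrajectory:
  assumes "topological_group K T" "compact_space T" "topological_automorphism K T \<psi>"
    and "U \<in> open_subgroups K T" "n > 0"
  shows "finite (rcosets\<^bsub>K\<^esub> (cotrajectory K \<psi> n U))"
  using assms by (intro finite_rcosets_open_subgroup cotrajectory_open_subgroup)

lemma finite_rcosets_plus_part:
  assumes "topological_group K T" "compact_space T" "topological_automorphism K T \<psi>"
    and "U \<in> open_subgroups K T"
  shows "finite (rcosets\<^bsub>K\<lparr>carrier := \<psi> ` plus_part K \<psi> U\<rparr>\<^esub> (plus_part K \<psi> U))"
proof -
  interpret group K using assms(1) by (simp add: topological_group_def)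
  let ?P = "plus_part K \<psi> U" let ?Q = "\<psi> ` plus_part K \<psi> U"
  have o: "aut_power K \<psi> m ` U \<in> open_subgroups K T" for m
    by (rule aut_power_image_open_subgroup[OF assms(1,3,4)])
  have UK: "subgroup U K" using assms(4) by (simp add: open_subgroups_def)
  have UC: "U \<subseteq> carrier K" using UK by (rule subgroup.subset)
  have iso: "\<psi> \<in> iso K K" using assms(3) by (simp add: topological_automorphism_def)
  have hom: "group_hom K K \<psi>"
    using iso by (simp add: group_hom_def group_hom_axioms_def iso_def is_group)
  have Psub: "subgroup ?P K"
    unfolding plus_part_def using o by (intro subgroups_Inter) (auto simp: open_subgroups_def)
  have Qsub: "subgroup ?Q K" using Psub hom by (simp add: group_hom.subgroup_img_is_subgroup)
  have PU: "?P \<subseteq> U"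
    unfolding plus_part_def by (rule INF_lower2[of 0]) (auto simp: aut_power_def)
  have key: "x \<in> ?P" if xQ: "x \<in> ?Q" and xU: "x \<in> U" for x
  proof -
    obtain y where y: "y \<in> ?P" "x = \<psi> y" using xQ by blast
    have "x \<in> (\<psi> ^^ n) ` U" for n
    proof (cases n)
      case 0
      then show ?thesis using xU by simp
    next
      case (Suc m)
      have "y \<in> (\<psi> ^^ m) ` U" using y(1) by (auto simp: plus_part_def aut_power_def)
      then show ?thesis using y(2) Suc by auto
    qed
    then show ?thesis by (auto simp: plus_part_def aut_power_def)
  qed
  let ?R = "rcosets\<^bsub>K\<lparr>carrier := ?Q\<rparr>\<^esub> ?P"
  have R: "?R = (\<lambda>a. ?P #>\<^bsub>K\<^esub> a) ` ?Q"
    by (auto simp: RCOSETS_def r_coset_def)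
  have QC: "?Q \<subseteq> carrier K" using Qsub by (rule subgroup.subset)
  have fin: "finite ((\<lambda>a. U #>\<^bsub>K\<^esub> a) ` ?Q)"
    using finite_rcosets_open_subgroup[OF assms(1,2,4)] QC
    by (rule_tac finite_subset) (auto simp: RCOSETS_def)
  have wd: "?P #>\<^bsub>K\<^esub> a = ?P #>\<^bsub>K\<^esub> b"
    if ab: "a \<in> ?Q" "b \<in> ?Q" and eq: "U #>\<^bsub>K\<^esub> a = U #>\<^bsub>K\<^esub> b" for a b
  proof -
    have ac: "a \<in> carrier K" "b \<in> carrier K" using ab QC by auto
    have "a \<in> U #>\<^bsub>K\<^esub> b" using rcos_self[OF ac(1) UK] eq by simp
    then obtain u where u: "u \<in> U" "a = u \<otimes>\<^bsub>K\<^esub> b" by (auto simp: r_coset_def)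
    have "u = a \<otimes>\<^bsub>K\<^esub> inv\<^bsub>K\<^esub> b" using u UC ac by (simp add: inv_solve_right subsetD)
    then have "u \<in> ?Q"
      using ab Qsub by (simp add: subgroup.m_closed subgroup.m_inv_closed)
    then have "u \<in> ?P" using key u(1) by blast
    then have "a \<in> ?P #>\<^bsub>K\<^esub> b" using u(2) by (auto simp: r_coset_def)
    then show ?thesis using repr_independence[OF _ ac(2) Psub] by simp
  qed
  have "?R \<subseteq> (\<lambda>C. ?P #>\<^bsub>K\<^esub> (SOME b. b \<in> ?Q \<and> U #>\<^bsub>K\<^esub> b = C)) ` ((\<lambda>a. U #>\<^bsub>K\<^esub> a) ` ?Q)"
  proof
    fix C assume "C \<in> ?R"
    then obtain a where a: "a \<in> ?Q" "C = ?P #>\<^bsub>K\<^esub> a" using R by auto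
    let ?b = "SOME b. b \<in> ?Q \<and> U #>\<^bsub>K\<^esub> b = U #>\<^bsub>K\<^esub> a"
    have "?b \<in> ?Q \<and> U #>\<^bsub>K\<^esub> ?b = U #>\<^bsub>K\<^esub> a" by (rule someI[of _ a]) (use a in simp)
    then have "C = ?P #>\<^bsub>K\<^esub> ?b" using wd[of a ?b] a by simp
    then show "C \<in> (\<lambda>C. ?P #>\<^bsub>K\<^esub> (SOME b. b \<in> ?Q \<and> U #>\<^bsub>K\<^esub> b = C)) ` ((\<lambda>a. U #>\<^bsub>K\<^esub> a) ` ?Q)"
      using a(1) by blast
  qed
  then show ?thesis using fin finite_surj by blast
qed

end

theory Submission
  imports Defs
begin

text \<open>
  Let \<open>U\<close> be any open subgroup, antistable or not, with cotrajectories \<open>C\<^sub>n\<close>. Passing from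
  \<open>C\<^sub>n\<close> to \<open>C\<^sub>n \<inter> \<psi>\<^sup>-\<^sup>n(U)\<close> multiplies the index in \<open>K\<close> by the number of
  cosets of \<open>\<psi>\<^sup>-\<^sup>n(U)\<close> that meet \<open>C\<^sub>n\<close> (\<open>num_cosets_Int_mult\<close>). Transported by
  \<open>\<psi>\<^sup>n\<close>, this is the number of cosets of \<open>U\<close> that meet
  \<open>\<psi>(U) \<inter> \<dots> \<inter> \<psi>\<^sup>n(U)\<close>. These closed sets decrease to \<open>\<psi>(U\<^sub>+)\<close>, and \<open>U\<close> has
  only finitely many cosets, so by compactness (\<open>cosets_meeting_decseq_stabilise\<close>) the
  number is eventually that of the cosets of \<open>U\<close> meeting \<open>\<psi>(U\<^sub>+)\<close>. Because
  \<open>U \<inter> \<psi>(U\<^sub>+) = U\<^sub>+\<close>, the latter number is \<open>[\<psi>(U\<^sub>+) : U\<^sub>+]\<close>. Hence \<open>[K : C\<^sub>n]\<close>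
  is eventually a geometric progression of ratio \<open>[\<psi>(U\<^sub>+) : U\<^sub>+]\<close>, and the entropy with
  respect to \<open>U\<close> is the logarithm of this ratio (\<open>H_top_eq_ln_expansion\<close>).

  Suppose now that \<open>U\<close> is antistable and \<open>V\<close> is any open subgroup. The sets
  \<open>\<psi>\<^sup>-\<^sup>N(U) \<inter> \<dots> \<inter> \<psi>\<^sup>N(U)\<close> decrease to the trivial group, so by compactness one of them
  lies in \<open>V\<close>. Then the \<open>n\<close>-th cotrajectory of \<open>V\<close> contains the image under \<open>\<psi>\<^sup>N\<close> of
  the cotrajectory of \<open>U\<close> of length \<open>n + 2N\<close>; comparing growth rates, the ratio of \<open>V\<close> is
  at most that of \<open>U\<close> (\<open>expansion_le_antistable\<close>). So antistable subgroups all have the same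
  ratio, which is therefore the depth, and they attain the supremum that defines the
  entropy of \<open>\<psi>\<close>.
\<close>

section \<open>Counting right cosets\<close>

lemma card_image_eq_if_same_kernel:
  assumes "\<And>a b. a \<in> A \<Longrightarrow> b \<in> A \<Longrightarrow> f a = f b \<longleftrightarrow> g a = g b"
  shows "card (f ` A) = card (g ` A)"
proof -
  let ?r = "inv_into A f"
  have r: "?r c \<in> A" "f (?r c) = c" if "c \<in> f ` A" for c
    using that by (simp_all add: inv_into_into f_inv_into_f)
  have "bij_betw (\<lambda>c. g (?r c)) (f ` A) (g ` A)"
    unfolding bij_betw_def
  proof
    show "inj_on (\<lambda>c. g (?r c)) (f ` A)"
    proof (rule inj_onI)
      fix c d assume cd: "c \<in> f ` A" "d \<in> f ` A" "g (?r c) = g (?r d)"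
      then have "f (?r c) = f (?r d)" using assms r(1) by blast
      then show "c = d" using r(2) cd by simp
    qed
    have "g (?r (f a)) = g a" if "a \<in> A" for a
      using assms[of "?r (f a)" a] r[of "f a"] that by simp
    then show "(\<lambda>c. g (?r c)) ` f ` A = g ` A"
      by (simp add: image_image cong: image_cong)
  qed
  then show ?thesis by (rule bij_betw_same_card)
qed

context group
begin

text \<open>
  The index \<open>[A : U]\<close> when \<open>U \<subseteq> A\<close>. For subgroups \<open>U\<close> and \<open>A\<close> in general position it is
  \<open>[A : U \<inter> A]\<close>, but computed with cosets of \<open>U\<close>; this makes it monotone in \<open>A\<close> and bounded
  by the number of all cosets of \<open>U\<close>.
\<close>

definition num_cosets :: "'a set \<Rightarrow> 'a set \<Rightarrow> nat" where
  "num_cosets U A = card ((\<lambda>a. U #> a) ` A)"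

lemma rcos_eq_iff:
  assumes "subgroup U G" "a \<in> carrier G" "b \<in> carrier G"
  shows "U #> a = U #> b \<longleftrightarrow> a \<otimes> inv b \<in> U"
  by (metis assms is_group rcos_self repr_independence subgroup.rcos_module)

lemma subgroup_index_eq_num_cosets: "subgroup_index G H L = num_cosets L H"
  unfolding subgroup_index_def num_cosets_def
  by (rule arg_cong[where f = card]) (auto simp: RCOSETS_def r_coset_def)

lemma num_cosets_Int:
  assumes "subgroup U G" "subgroup Q G"
  shows "num_cosets (U \<inter> Q) Q = num_cosets U Q"
  unfolding num_cosets_def
proof (rule card_image_eq_if_same_kernel)
  fix a b assume ab: "a \<in> Q" "b \<in> Q"
  then have c: "a \<in> carrier G" "b \<in> carrier G"
    using assms(2) subgroup.subset by blast+
  have "a \<otimes> inv b \<in> Q"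
    using ab assms(2) by (simp add: subgroup.m_closed subgroup.m_inv_closed)
  then show "(U \<inter> Q) #> a = (U \<inter> Q) #> b \<longleftrightarrow> U #> a = U #> b"
    using c assms by (simp add: rcos_eq_iff subgroups_Inter_pair)
qed

lemma num_cosets_iso_image:
  assumes h: "h \<in> iso G G" and U: "subgroup U G" and A: "A \<subseteq> carrier G"
  shows "num_cosets (h ` U) (h ` A) = num_cosets U A"
proof -
  interpret h: group_hom G G h
    using h by (simp add: group_hom_def group_hom_axioms_def iso_def is_group)
  have inj: "inj_on h (carrier G)" using h by (auto simp: iso_def bij_betw_def)
  have UG: "U \<subseteq> carrier G" using U by (rule subgroup.subset)
  have "card ((\<lambda>a. (h ` U) #> h a) ` A) = card ((\<lambda>a. U #> a) ` A)"
  proof (rule card_image_eq_if_same_kernel)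
    fix a b assume "a \<in> A" "b \<in> A"
    then have c: "a \<in> carrier G" "b \<in> carrier G" using A by auto
    have "h a \<otimes> inv (h b) \<in> h ` U \<longleftrightarrow> h (a \<otimes> inv b) \<in> h ` U" using c by simp
    also have "\<dots> \<longleftrightarrow> a \<otimes> inv b \<in> U"
      using c UG inj by (intro inj_on_image_mem_iff) auto
    finally show "(h ` U) #> h a = (h ` U) #> h b \<longleftrightarrow> U #> a = U #> b"
      using c U h.subgroup_img_is_subgroup[OF U] by (simp add: rcos_eq_iff)
  qed
  then show ?thesis by (simp add: num_cosets_def image_image)
qed

text \<open>
  Once a representative \<open>r\<close> is fixed in every coset of \<open>A\<close>, an element \<open>x\<close> is determined
  modulo \<open>A \<inter> B\<close> by its coset \<open>A #> x\<close> together with the coset of \<open>B\<close> that contains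
  \<open>x \<otimes> inv r\<close>, an element of \<open>A\<close>; and every such pair of cosets occurs.
\<close>

lemma num_cosets_Int_mult:
  assumes A: "subgroup A G" and B: "subgroup B G"
  shows "num_cosets (A \<inter> B) (carrier G) = num_cosets A (carrier G) * num_cosets B A"
proof -
  define r where "r C = (SOME x. x \<in> C)" for C :: "'a set"
  have AG: "A \<subseteq> carrier G" using A by (rule subgroup.subset)
  have rin: "r (A #> x) \<in> A #> x" if "x \<in> carrier G" for x
    unfolding r_def using rcos_self[OF that A] by (rule someI)
  have rc: "r (A #> x) \<in> carrier G" if "x \<in> carrier G" for x
    using rin[OF that] r_coset_subset_G[OF AG that] by blast
  have req: "A #> r (A #> x) = A #> x" if "x \<in> carrier G" for x
    using repr_independence[OF rin[OF that] that A] by simp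
  have xr: "x \<otimes> inv r (A #> x) \<in> A" if "x \<in> carrier G" for x
    using rcos_eq_iff[OF A that rc[OF that]] req[OF that] by simp
  let ?g = "\<lambda>x. (A #> x, B #> (x \<otimes> inv r (A #> x)))"
  have "num_cosets (A \<inter> B) (carrier G) = card (?g ` carrier G)"
    unfolding num_cosets_def
  proof (rule card_image_eq_if_same_kernel)
    fix x y assume c: "x \<in> carrier G" "y \<in> carrier G"
    have Beq: "B #> (x \<otimes> inv r (A #> x)) = B #> (y \<otimes> inv r (A #> x)) \<longleftrightarrow> x \<otimes> inv y \<in> B"
    proof -
      let ?s = "r (A #> x)"
      have s: "?s \<in> carrier G" using rc c by simp
      then have "inv ?s \<otimes> (?s \<otimes> inv y) = inv y"
        using c by (simp flip: m_assoc)
      then have "(x \<otimes> inv ?s) \<otimes> inv (y \<otimes> inv ?s) = x \<otimes> inv y"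
        using c s by (simp add: inv_mult_group m_assoc)
      then show ?thesis
        using rcos_eq_iff[OF B, of "x \<otimes> inv ?s" "y \<otimes> inv ?s"] c s by simp
    qed
    have Aeq: "A #> x = A #> y \<longleftrightarrow> x \<otimes> inv y \<in> A" by (rule rcos_eq_iff[OF A c])
    have "(A \<inter> B) #> x = (A \<inter> B) #> y \<longleftrightarrow> x \<otimes> inv y \<in> A \<and> x \<otimes> inv y \<in> B"
      using rcos_eq_iff[OF subgroups_Inter_pair[OF A B] c] by simp
    also have "\<dots> \<longleftrightarrow> ?g x = ?g y"
    proof (cases "A #> x = A #> y")
      case True
      then show ?thesis using Beq Aeq by simp
    next
      case False
      then show ?thesis using Aeq by simp
    qed
    finally show "(A \<inter> B) #> x = (A \<inter> B) #> y \<longleftrightarrow> ?g x = ?g y" .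
  qed
  also have "?g ` carrier G = ((\<lambda>x. A #> x) ` carrier G) \<times> ((\<lambda>a. B #> a) ` A)"
  proof
    show "?g ` carrier G \<subseteq> ((\<lambda>x. A #> x) ` carrier G) \<times> ((\<lambda>a. B #> a) ` A)"
      using xr by auto
    show "((\<lambda>x. A #> x) ` carrier G) \<times> ((\<lambda>a. B #> a) ` A) \<subseteq> ?g ` carrier G"
    proof clarify
      fix c a assume c: "c \<in> carrier G" and a: "a \<in> A"
      let ?x = "a \<otimes> r (A #> c)"
      have ac: "a \<in> carrier G" using a AG by blast
      have "A #> ?x = A #> c"
        using req[OF c] rc[OF c] ac a A
        by (metis coset_join2 coset_mult_assoc AG)
      moreover have "?x \<otimes> inv r (A #> c) = a" using ac rc[OF c] by (simp add: m_assoc)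
      ultimately have "(A #> c, B #> a) = ?g ?x" by simp
      moreover have "?x \<in> carrier G" using ac rc[OF c] by simp
      ultimately show "(A #> c, B #> a) \<in> ?g ` carrier G" by blast
    qed
  qed
  finally show ?thesis by (simp add: num_cosets_def card_cartesian_product)
qed

end

section \<open>Compact groups and integer powers of an automorphism\<close>

locale compact_group_automorphism =
  fixes K :: "('a, 'b) monoid_scheme" (structure)
    and T :: "'a topology" and \<psi> :: "'a \<Rightarrow> 'a"
  assumes tg: "topological_group K T"
    and comp: "compact_space T"
    and aut: "topological_automorphism K T \<psi>"
begin

sublocale group K using tg by (simp add: topological_group_def)

lemma topspace_eq [simp]: "topspace T = carrier K"
  using tg by (simp add: topological_group_def)

lemma open_subgroup_subset: "U \<in> open_subgroups K T \<Longrightarrow> U \<subseteq> carrier K"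
  by (auto simp: open_subgroups_def dest: subgroup.subset)

lemma open_subgroup_subgroup: "U \<in> open_subgroups K T \<Longrightarrow> subgroup U K"
  by (simp add: open_subgroups_def)

lemma num_cosets_pos:
  assumes "U \<in> open_subgroups K T" "A \<subseteq> carrier K" "A \<noteq> {}"
  shows "num_cosets U A > 0"
proof -
  have "finite ((\<lambda>a. U #> a) ` A)"
    using finite_rcosets_open_subgroup[OF tg comp assms(1)] assms(2)
    by (rule_tac finite_subset) (auto simp: RCOSETS_def)
  then show ?thesis using assms(3) by (simp add: num_cosets_def card_gt_0_iff)
qed

lemma num_cosets_antimono:
  assumes "U \<in> open_subgroups K T" "V \<in> open_subgroups K T" "U \<subseteq> V"
  shows "num_cosets V (carrier K) \<le> num_cosets U (carrier K)"
proof -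
  have "num_cosets U (carrier K) = num_cosets V (carrier K) * num_cosets U V"
    using num_cosets_Int_mult[of V U] assms by (simp add: open_subgroups_def Int_absorb1)
  moreover have "num_cosets U V > 0"
    using assms(2) subgroup.one_closed[OF open_subgroup_subgroup[OF assms(2)]]
    by (intro num_cosets_pos assms open_subgroup_subset) auto
  ultimately show ?thesis by simp
qed

lemma openin_rcos:
  assumes U: "U \<in> open_subgroups K T" and a: "a \<in> carrier K"
  shows "openin T (U #> a)"
proof -
  have "continuous_map T (prod_topology T T) (\<lambda>x. (x, inv a))"
    using a by (intro continuous_map_pairedI) auto
  moreover have "continuous_map (prod_topology T T) T (\<lambda>(x, y). x \<otimes> y)"
    using tg by (simp add: topological_group_def)
  ultimately have "continuous_map T T ((\<lambda>(x, y). x \<otimes> y) \<circ> (\<lambda>x. (x, inv a)))"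
    by (rule continuous_map_compose)
  then have "openin T {x \<in> topspace T. ((\<lambda>(x, y). x \<otimes> y) \<circ> (\<lambda>x. (x, inv a))) x \<in> U}"
    by (rule openin_continuous_map_preimage) (use U in \<open>simp add: open_subgroups_def\<close>)
  moreover have "{x \<in> topspace T. ((\<lambda>(x, y). x \<otimes> y) \<circ> (\<lambda>x. (x, inv a))) x \<in> U} = U #> a"
    using a open_subgroup_subset[OF U] by (force simp: r_coset_def m_assoc inv_solve_right)
  ultimately show ?thesis by simp
qed

lemma closedin_rcos:
  assumes U: "U \<in> open_subgroups K T" and a: "a \<in> carrier K"
  shows "closedin T (U #> a)"
proof -
  note s = open_subgroup_subgroup[OF U]
  have "topspace T - (U #> a) = \<Union> (rcosets U - {U #> a})"
    using rcosets_part_G[OF s] rcos_disjoint[OF s] rcosetsI[OF open_subgroup_subset[OF U] a]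
    unfolding pairwise_def disjnt_def by auto
  moreover have "openin T (\<Union> (rcosets U - {U #> a}))"
    using openin_rcos[OF U] by (intro openin_Union) (auto simp: RCOSETS_def)
  ultimately show ?thesis
    using r_coset_subset_G[OF open_subgroup_subset[OF U] a] by (simp add: closedin_def)
qed

lemma closedin_open_subgroup:
  assumes "U \<in> open_subgroups K T"
  shows "closedin T U"
  using closedin_rcos[OF assms one_closed] open_subgroup_subset[OF assms] by simp

text \<open>
  A coset of \<open>U\<close> that meets every \<open>F n\<close> meets the intersection, by compactness. There are
  only finitely many cosets, so those that miss the intersection miss a common \<open>F n\<close>.
\<close>

lemma cosets_meeting_decseq_stabilise:
  assumes U: "U \<in> open_subgroups K T"
    and F: "\<And>n. closedin T (F n)" "decseq F"
  obtains N where "\<And>n. n \<ge> N \<Longrightarrow> (\<lambda>a. U #> a) ` F n = (\<lambda>a. U #> a) ` (\<Inter>n. F n)"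
proof -
  note s = open_subgroup_subgroup[OF U]
  have FK: "F n \<subseteq> carrier K" for n using closedin_subset[OF F(1)[of n]] by simp
  have miss: "\<exists>n. C \<inter> F n = {}" if C: "C \<in> rcosets U" "C \<inter> (\<Inter>n. F n) = {}" for C
  proof (rule ccontr)
    assume "\<not> ?thesis"
    moreover have "closedin T (C \<inter> F n)" for n
      using C(1) closedin_rcos[OF U] F(1) by (auto simp: RCOSETS_def)
    moreover have "decseq (\<lambda>n. C \<inter> F n)" using F(2) unfolding decseq_def by blast
    ultimately have "(\<Inter>n. C \<inter> F n) \<noteq> {}" by (intro compact_space_imp_nest[OF comp]) auto
    then show False using C(2) by auto
  qed
  define m where "m C = (LEAST n. C \<inter> F n = {})" for C
  define N where "N = Max (insert 0 (m ` (rcosets U)))"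
  have fin: "finite (rcosets U)" by (rule finite_rcosets_open_subgroup[OF tg comp U])
  show thesis
  proof (rule that[of N])
    fix n assume n: "n \<ge> N"
    have "\<exists>b \<in> (\<Inter>n. F n). U #> a = U #> b" if a: "a \<in> F n" for a
    proof (rule ccontr)
      assume neg: "\<not> ?thesis"
      have ac: "a \<in> carrier K" using a FK by blast
      have C: "U #> a \<in> rcosets U" using ac open_subgroup_subset[OF U] by (rule_tac rcosetsI)
      have "(U #> a) \<inter> (\<Inter>n. F n) = {}"
        using neg repr_independence[OF _ ac s] by blast
      then have "(U #> a) \<inter> F (m (U #> a)) = {}"
        unfolding m_def using miss[OF C] by (metis (mono_tags, lifting) LeastI)
      moreover have "m (U #> a) \<le> n" using C fin n by (auto simp: N_def)
      then have "F n \<subseteq> F (m (U #> a))" using F(2) by (simp add: decseq_def)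
      ultimately show False using a rcos_self[OF ac s] by blast
    qed
    then show "(\<lambda>a. U #> a) ` F n = (\<lambda>a. U #> a) ` (\<Inter>n. F n)" by blast
  qed
qed

abbreviation pw :: "int \<Rightarrow> 'a \<Rightarrow> 'a" where "pw \<equiv> aut_power K \<psi>"

lemma iso_\<psi>: "\<psi> \<in> iso K K"
  using aut by (simp add: topological_automorphism_def)

lemma bij_\<psi>: "bij_betw \<psi> (carrier K) (carrier K)"
  using iso_\<psi> by (simp add: iso_def)

lemma pw_iso: "pw n \<in> iso K K"
proof -
  have "(f ^^ k) \<in> iso K K" if "f \<in> iso K K" for f and k :: nat
  proof (induction k)
    case 0
    show ?case using iso_set_refl by (simp add: id_def)
  next
    case (Suc k)
    then show ?case unfolding funpow.simps by (rule iso_set_trans) (rule that)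
  qed
  then show ?thesis using iso_\<psi> iso_set_sym[OF iso_\<psi>] by (simp add: aut_power_def)
qed

lemma pw_bij: "bij_betw (pw n) (carrier K) (carrier K)"
  using pw_iso by (simp add: iso_def)

lemma pw_closed: "x \<in> carrier K \<Longrightarrow> pw n x \<in> carrier K"
  using pw_bij bij_betwE by blast

lemma pw_0 [simp]: "pw 0 = id"
  by (auto simp: aut_power_def)

lemma pw_1 [simp]: "pw 1 = \<psi>"
  by (auto simp: aut_power_def)

lemma pw_succ:
  assumes "x \<in> carrier K"
  shows "pw (n + 1) x = \<psi> (pw n x)"
proof (cases "n \<ge> 0")
  case True
  then show ?thesis by (simp add: aut_power_def nat_add_distrib)
next
  case False
  let ?i = "inv_into (carrier K) \<psi>"
  have "pw n x = ?i (pw (n + 1) x)"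
  proof -
    have "nat (- n) = Suc (nat (- (n + 1)))" using False by simp
    then show ?thesis using False by (auto simp: aut_power_def)
  qed
  then show ?thesis
    using bij_betw_inv_into_right[OF bij_\<psi>] pw_closed[OF assms] by simp
qed

lemma pw_add:
  assumes x: "x \<in> carrier K"
  shows "pw (m + n) x = pw m (pw n x)"
proof (induction m rule: int_induct[where k = 0])
  case base
  show ?case by simp
next
  case (step1 i)
  then show ?case
    using pw_succ[OF x, of "i + n"] pw_succ[OF pw_closed[OF x], of i] by (simp add: algebra_simps)
next
  case (step2 i)
  have "\<psi> (pw (i - 1 + n) x) = \<psi> (pw (i - 1) (pw n x))"
    using step2 pw_succ[OF x, of "i - 1 + n"] pw_succ[OF pw_closed[OF x], of "i - 1"] by simp
  then show ?case
    using bij_\<psi> pw_closed x by (auto simp: bij_betw_def inj_on_def)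
qed

lemma pw_image_add:
  assumes "U \<subseteq> carrier K"
  shows "pw m ` pw n ` U = pw (m + n) ` U"
  unfolding image_image using assms pw_add by (intro image_cong) (auto simp: subset_iff)

lemma pw_image_INT:
  assumes "U \<subseteq> carrier K" "I \<noteq> {}"
  shows "pw m ` (\<Inter>i\<in>I. pw (f i) ` U) = (\<Inter>i\<in>I. pw (m + f i) ` U)"
proof -
  obtain j where j: "j \<in> I" using assms(2) by blast
  have "pw m ` (\<Inter>i\<in>I. pw (f i) ` U) = (\<Inter>i\<in>I. pw m ` pw (f i) ` U)"
    using assms(1) pw_closed pw_bij
    by (intro image_INT[where C = "carrier K", OF _ _ j]) (auto simp: bij_betw_def)
  then show ?thesis using assms(1) by (simp add: pw_image_add)
qed

lemma pw_image_open_subgroup: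
  "U \<in> open_subgroups K T \<Longrightarrow> pw n ` U \<in> open_subgroups K T"
  by (rule aut_power_image_open_subgroup[OF tg aut])

lemma closedin_INT_pw:
  assumes "U \<in> open_subgroups K T" "I \<noteq> {}"
  shows "closedin T (\<Inter>i\<in>I. pw (f i) ` U)"
proof (rule closedin_INT)
  show "closedin T (pw (f i) ` U)" for i
    by (intro closedin_open_subgroup pw_image_open_subgroup assms)
qed (rule assms)

lemma subgroup_INT_pw:
  assumes "U \<in> open_subgroups K T" "I \<noteq> {}"
  shows "subgroup (\<Inter>i\<in>I. pw (f i) ` U) K"
proof (rule subgroups_Inter)
  show "subgroup H K" if "H \<in> (\<lambda>i. pw (f i) ` U) ` I" for H
    using that pw_image_open_subgroup[OF assms(1)] open_subgroup_subgroup by blast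
qed (use assms in simp)

section \<open>Entropy with respect to an open subgroup\<close>

text \<open>The quantity whose value at antistable \<open>U\<close> is the depth, here for arbitrary \<open>U\<close>.\<close>

definition expansion :: "'a set \<Rightarrow> nat" where
  "expansion U = subgroup_index K (\<psi> ` plus_part K \<psi> U) (plus_part K \<psi> U)"

abbreviation cotraj_index :: "'a set \<Rightarrow> nat \<Rightarrow> nat" where
  "cotraj_index U n \<equiv> num_cosets (cotrajectory K \<psi> n U) (carrier K)"

lemma psi_plus_part:
  assumes "U \<in> open_subgroups K T"
  shows "\<psi> ` plus_part K \<psi> U = (\<Inter>n. pw (int n + 1) ` U)"
  using pw_image_INT[OF open_subgroup_subset[OF assms], of UNIV 1 int]
  by (simp add: plus_part_def add.commute)

lemma expansion_eq_num_cosets: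
  assumes U: "U \<in> open_subgroups K T"
  shows "expansion U = num_cosets U (\<psi> ` plus_part K \<psi> U)"
proof -
  have "plus_part K \<psi> U = U \<inter> \<psi> ` plus_part K \<psi> U"
  proof (rule Set.set_eqI)
    fix x
    have "(\<forall>n. x \<in> pw (int n) ` U) \<longleftrightarrow> x \<in> pw (int 0) ` U \<and> (\<forall>n. x \<in> pw (int (Suc n)) ` U)"
      by (metis not0_implies_Suc)
    then show "x \<in> plus_part K \<psi> U \<longleftrightarrow> x \<in> U \<inter> \<psi> ` plus_part K \<psi> U"
      unfolding psi_plus_part[OF U] by (simp add: plus_part_def add.commute)
  qed
  then have "expansion U = num_cosets (U \<inter> \<psi> ` plus_part K \<psi> U) (\<psi> ` plus_part K \<psi> U)"
    by (simp add: expansion_def subgroup_index_eq_num_cosets)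
  also have "\<dots> = num_cosets U (\<psi> ` plus_part K \<psi> U)"
    using subgroup_INT_pw[OF U, of UNIV "\<lambda>n. int n + 1"] open_subgroup_subgroup[OF U]
    by (intro num_cosets_Int) (auto simp: psi_plus_part[OF U])
  finally show ?thesis .
qed

lemma expansion_pos:
  assumes U: "U \<in> open_subgroups K T"
  shows "expansion U > 0"
proof -
  have "subgroup (\<psi> ` plus_part K \<psi> U) K"
    using subgroup_INT_pw[OF U, of UNIV "\<lambda>n. int n + 1"] by (simp add: psi_plus_part[OF U])
  then show ?thesis
    unfolding expansion_eq_num_cosets[OF U]
    by (intro num_cosets_pos[OF U]) (auto dest: subgroup.subset subgroup.one_closed)
qed

lemma cotraj_index_pos:
  assumes "U \<in> open_subgroups K T" "n > 0"
  shows "cotraj_index U n > 0"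
  using cotrajectory_open_subgroup[OF tg aut assms] one_closed by (intro num_cosets_pos) auto

text \<open>
  The factor is the number of cosets of the newly added set \<open>pw (- int (Suc n)) ` U\<close> that
  meet the previous cotrajectory. Applying \<open>pw (int (Suc n))\<close> to both turns it into a count of cosets of the
  fixed group \<open>U\<close>, in a set that decreases with \<open>n\<close>. The recursion starts at length one
  because the cotrajectory of length zero is the whole type, not the group.
\<close>

lemma cotraj_index_Suc:
  assumes U: "U \<in> open_subgroups K T"
  shows "cotraj_index U (Suc (Suc n)) =
    cotraj_index U (Suc n) * num_cosets U (\<Inter>k\<le>n. pw (int k + 1) ` U)"
proof -
  let ?C = "cotrajectory K \<psi> (Suc n) U"
  note UK = open_subgroup_subset[OF U]
  have C: "?C \<in> open_subgroups K T" by (rule cotrajectory_open_subgroup[OF tg aut U]) simp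
  have "cotrajectory K \<psi> (Suc (Suc n)) U = ?C \<inter> pw (- int (Suc n)) ` U"
    unfolding cotrajectory_def lessThan_Suc[of "Suc n"] by auto
  then have "cotraj_index U (Suc (Suc n)) =
      cotraj_index U (Suc n) * num_cosets (pw (- int (Suc n)) ` U) ?C"
    using C pw_image_open_subgroup[OF U] by (simp add: num_cosets_Int_mult open_subgroups_def)
  also have "num_cosets (pw (- int (Suc n)) ` U) ?C =
      num_cosets (pw (int (Suc n)) ` pw (- int (Suc n)) ` U) (pw (int (Suc n)) ` ?C)"
    using pw_image_open_subgroup[OF U] open_subgroup_subset[OF C]
    by (intro num_cosets_iso_image[symmetric] pw_iso) (auto simp: open_subgroups_def)
  also have "pw (int (Suc n)) ` pw (- int (Suc n)) ` U = U"
    by (simp add: pw_image_add[OF UK])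
  also have "pw (int (Suc n)) ` ?C = (\<Inter>k<Suc n. pw (int (Suc n) + - int k) ` U)"
    unfolding cotrajectory_def by (rule pw_image_INT[OF UK]) auto
  also have "\<dots> = (\<Inter>k\<le>n. pw (int k + 1) ` U)"
  proof -
    \<comment> \<open>The indices on both sides run through \<open>1, \<dots>, n + 1\<close>, in opposite order.\<close>
    have "(\<lambda>k. int (Suc n) + - int k) ` {..<Suc n} = (\<lambda>k. int k + 1) ` {..n}" (is "?l = ?r")
    proof
      show "?l \<subseteq> ?r"
      proof
        fix z assume "z \<in> ?l"
        then obtain k where "k \<le> n" "z = int (Suc n) - int k" by auto
        then show "z \<in> ?r" by (intro image_eqI[of _ _ "n - k"]) (auto simp: of_nat_diff)
      qed
      show "?r \<subseteq> ?l"
      proof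
        fix z assume "z \<in> ?r"
        then obtain k where "k \<le> n" "z = int k + 1" by auto
        then show "z \<in> ?l" by (intro image_eqI[of _ _ "n - k"]) (auto simp: of_nat_diff)
      qed
    qed
    then have "(\<Inter>z\<in>?l. pw z ` U) = (\<Inter>z\<in>?r. pw z ` U)" by simp
    then show ?thesis by (simp only: image_image)
  qed
  finally show ?thesis .
qed

lemma cotraj_index_eventually_geometric:
  assumes U: "U \<in> open_subgroups K T"
  obtains N where "N > 0" "\<And>n. cotraj_index U (N + n) = cotraj_index U N * expansion U ^ n"
proof -
  let ?F = "\<lambda>n. \<Inter>k\<le>n. pw (int k + 1) ` U"
  have "closedin T (?F n)" for n
    using closedin_INT_pw[OF U, of "{..n}" "\<lambda>k. int k + 1"] by simp
  moreover have "decseq ?F" unfolding decseq_def by (auto intro!: INF_superset_mono)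
  ultimately obtain N where
    N: "\<And>n. n \<ge> N \<Longrightarrow> (\<lambda>a. U #> a) ` ?F n = (\<lambda>a. U #> a) ` (\<Inter>n. ?F n)"
    by (rule cosets_meeting_decseq_stabilise[OF U]) blast
  have "(\<Inter>n. ?F n) = \<psi> ` plus_part K \<psi> U" unfolding psi_plus_part[OF U] by blast
  then have num: "num_cosets U (?F n) = expansion U" if "n \<ge> N" for n
    using N[OF that] by (simp only: num_cosets_def expansion_eq_num_cosets[OF U])
  have "cotraj_index U (Suc N + n) = cotraj_index U (Suc N) * expansion U ^ n" for n
  proof (induction n)
    case (Suc n)
    then show ?case using cotraj_index_Suc[OF U, of "N + n"] num[of "N + n"] by simp
  qed simp
  then show thesis using that[of "Suc N"] by blast
qed

lemma log_cotraj_index_tendsto: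
  assumes U: "U \<in> open_subgroups K T"
  shows "(\<lambda>n. ln (real (cotraj_index U n)) / real n) \<longlonglongrightarrow> ln (real (expansion U))"
proof -
  obtain N where N: "N > 0"
      "\<And>n. cotraj_index U (N + n) = cotraj_index U N * expansion U ^ n"
    by (rule cotraj_index_eventually_geometric[OF U]) blast
  let ?c = "ln (real (cotraj_index U N))" and ?d = "ln (real (expansion U))"
  have eq: "ln (real (cotraj_index U n)) = ?c + real (n - N) * ?d" if "n \<ge> N" for n
    using N(2)[of "n - N"] that cotraj_index_pos[OF U N(1)] expansion_pos[OF U]
    by (simp add: ln_mult ln_realpow)
  have "(\<lambda>n. (?c - real N * ?d) / real n + ?d) \<longlonglongrightarrow> 0 + ?d"
    by (intro tendsto_add lim_const_over_n tendsto_const)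
  moreover have "\<forall>\<^sub>F n in sequentially.
      (?c - real N * ?d) / real n + ?d = ln (real (cotraj_index U n)) / real n"
    using eventually_ge_at_top[of N]
  proof eventually_elim
    case (elim n)
    then have "n > 0" using N(1) by simp
    then show ?case using eq[OF elim] elim by (simp add: field_simps of_nat_diff)
  qed
  ultimately show ?thesis by (simp add: Lim_transform_eventually)
qed

lemma H_top_eq_ln_expansion:
  assumes "U \<in> open_subgroups K T"
  shows "H_top K \<psi> U = ln (real (expansion U))"
  unfolding H_top_def subgroup_index_eq_num_cosets
  by (rule limI[OF log_cotraj_index_tendsto[OF assms]])

section \<open>Antistable subgroups maximise the entropy\<close>

text \<open>
  The finite windows decrease to \<open>{\<one>}\<close>, which meets only the coset \<open>V\<close> of \<open>V\<close>; from some
  window on, no other coset is met either, so the window lies in \<open>V\<close>.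
\<close>

lemma antistable_window_subset:
  assumes U: "U \<in> open_subgroups K T" "antistable K \<psi> U" and V: "V \<in> open_subgroups K T"
  obtains N :: nat where "(\<Inter>i\<in>{- int N..int N}. pw i ` U) \<subseteq> V"
proof -
  let ?F = "\<lambda>n. \<Inter>i\<in>{- int n..int n}. pw i ` U"
  have "closedin T (?F n)" for n
    using closedin_INT_pw[OF U(1), of "{- int n..int n}" "\<lambda>i. i"] by simp
  moreover have "decseq ?F" unfolding decseq_def by (auto intro!: INF_superset_mono)
  ultimately obtain N where
    N: "\<And>n. n \<ge> N \<Longrightarrow> (\<lambda>a. V #> a) ` ?F n = (\<lambda>a. V #> a) ` (\<Inter>n. ?F n)"
    by (rule cosets_meeting_decseq_stabilise[OF V]) blast
  have "(\<Inter>n. ?F n) = (\<Inter>i. pw i ` U)"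
  proof
    show "(\<Inter>n. ?F n) \<subseteq> (\<Inter>i. pw i ` U)"
    proof (rule INT_greatest)
      fix i :: int
      have "i \<in> {- int (nat \<bar>i\<bar>)..int (nat \<bar>i\<bar>)}" by auto
      then show "(\<Inter>n. ?F n) \<subseteq> pw i ` U" by blast
    qed
  qed blast
  then have F: "(\<Inter>n. ?F n) = {\<one>}" using U(2) by (simp add: antistable_def)
  have "?F N \<subseteq> V"
  proof
    fix x assume x: "x \<in> ?F N"
    have "?F N \<subseteq> carrier K"
      using subgroup.subset[OF subgroup_INT_pw[OF U(1), of "{- int N..int N}" "\<lambda>i. i"]] by simp
    then have xc: "x \<in> carrier K" using x by blast
    have "V #> x \<in> (\<lambda>a. V #> a) ` ?F N" using x by (rule imageI)
    then have "V #> x = V #> \<one>" unfolding N[OF order_refl] F by simp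
    then show "x \<in> V" using xc by (simp add: rcos_eq_iff[OF open_subgroup_subgroup[OF V]])
  qed
  then show thesis by (rule that)
qed

text \<open>
  Refining \<open>V\<close> by a window of length \<open>2 * N + 1\<close> lengthens the cotrajectories of \<open>U\<close> by
  the constant \<open>2 * N\<close> only, and a constant shift of the length does not change the
  exponential growth rate of the index.
\<close>

lemma expansion_le_antistable:
  assumes U: "U \<in> open_subgroups K T" "antistable K \<psi> U" and V: "V \<in> open_subgroups K T"
  shows "expansion V \<le> expansion U"
proof -
  note UK = open_subgroup_subset[OF U(1)]
  obtain N :: nat where N: "(\<Inter>i\<in>{- int N..int N}. pw i ` U) \<subseteq> V"
    by (rule antistable_window_subset[OF U V])
  have le: "cotraj_index V n \<le> cotraj_index U (n + 2 * N)" if n: "n > 0" for n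
  proof -
    let ?C = "cotrajectory K \<psi> (n + 2 * N) U"
    have C: "?C \<in> open_subgroups K T"
      using n by (intro cotrajectory_open_subgroup[OF tg aut U(1)]) simp
    have shift: "pw (int N) ` ?C = (\<Inter>k<n + 2 * N. pw (int N - int k) ` U)"
      using pw_image_INT[OF UK, of "{..<n + 2 * N}" "int N" "\<lambda>k. - int k"] n
      by (simp add: cotrajectory_def lessThan_empty_iff)
    have "pw (int N) ` ?C \<subseteq> cotrajectory K \<psi> n V"
      unfolding cotrajectory_def[of K \<psi> n V]
    proof (rule INT_greatest)
      fix j assume j: "j \<in> {..<n}"
      have "pw (int N) ` ?C \<subseteq> (\<Inter>i\<in>{- int N..int N}. pw (- int j + i) ` U)"
      proof (rule INT_greatest)
        fix i assume i: "i \<in> {- int N..int N}"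
        \<comment> \<open>The place of \<open>- j + i\<close> when the exponents \<open>N, N - 1, \<dots>\<close> are counted downwards.\<close>
        define k where "k = nat (int N + int j - i)"
        have "k < n + 2 * N" "int N - int k = - int j + i" using i j by (auto simp: k_def)
        then show "pw (int N) ` ?C \<subseteq> pw (- int j + i) ` U" unfolding shift by (metis INT_lower lessThan_iff)
      qed
      also have "\<dots> = pw (- int j) ` (\<Inter>i\<in>{- int N..int N}. pw i ` U)"
        by (rule pw_image_INT[OF UK, symmetric]) simp
      also have "\<dots> \<subseteq> pw (- int j) ` V" using N by (rule image_mono)
      finally show "pw (int N) ` ?C \<subseteq> pw (- int j) ` V" .
    qed
    then have "cotraj_index V n \<le> num_cosets (pw (int N) ` ?C) (carrier K)"
      by (rule num_cosets_antimono[OF pw_image_open_subgroup[OF C]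
            cotrajectory_open_subgroup[OF tg aut V n]])
    also have "\<dots> = num_cosets (pw (int N) ` ?C) (pw (int N) ` carrier K)"
      using pw_bij by (simp add: bij_betw_def)
    also have "\<dots> = cotraj_index U (n + 2 * N)"
      using C by (intro num_cosets_iso_image pw_iso) (auto simp: open_subgroups_def)
    finally show ?thesis .
  qed
  \<comment> \<open>The last factor \<open>(n + 2 * N) / n\<close> turns division by \<open>n + 2 * N\<close> into division by \<open>n\<close>.\<close>
  have "(\<lambda>n. ln (real (cotraj_index U (n + 2 * N))) / real (n + 2 * N) *
      (1 + real (2 * N) / real n)) \<longlonglongrightarrow> ln (real (expansion U)) * (1 + 0)"
    using log_cotraj_index_tendsto[OF U(1)]
    by (intro tendsto_mult tendsto_add tendsto_const lim_const_over_n) (rule LIMSEQ_ignore_initial_segment)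
  moreover have "\<forall>\<^sub>F n in sequentially. ln (real (cotraj_index V n)) / real n \<le>
      ln (real (cotraj_index U (n + 2 * N))) / real (n + 2 * N) * (1 + real (2 * N) / real n)"
    using eventually_gt_at_top[of 0]
  proof eventually_elim
    case (elim n)
    have "ln (real (cotraj_index V n)) \<le> ln (real (cotraj_index U (n + 2 * N)))"
      using le[OF elim] cotraj_index_pos[OF V elim] by simp
    moreover have "1 + real (2 * N) / real n = real (n + 2 * N) / real n"
      using elim by (simp add: field_simps)
    ultimately show ?case using elim by (simp add: divide_right_mono)
  qed
  ultimately have "ln (real (expansion V)) \<le> ln (real (expansion U))"
    using tendsto_le[OF sequentially_bot _ log_cotraj_index_tendsto[OF V]] by simp
  then show ?thesis using expansion_pos U(1) V by simp
qed

lemma depth_eq_expansion: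
  assumes U: "U \<in> open_subgroups K T" "antistable K \<psi> U"
  shows "depth K T \<psi> = expansion U"
  unfolding depth_def
proof (rule the_equality)
  show "\<forall>V\<in>open_subgroups K T. antistable K \<psi> V \<longrightarrow>
      subgroup_index K (\<psi> ` plus_part K \<psi> V) (plus_part K \<psi> V) = expansion U"
    using expansion_le_antistable U by (auto simp: expansion_def[symmetric] intro: antisym)
qed (use U in \<open>auto simp: expansion_def\<close>)

end

theorem theorem5p2:
  fixes K :: "('a, 'b) monoid_scheme" and T :: "'a topology" and \<psi> :: "'a \<Rightarrow> 'a"
  assumes "topological_group K T"
    and "compact_space T"
    and "totally_disconnected_space T"
    and "topological_automorphism K T \<psi>"
    and "finite_depth K T \<psi>"
  shows "h_top K T \<psi> = ereal (ln (real (depth K T \<psi>)))"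
proof -
  interpret compact_group_automorphism K T \<psi> by unfold_locales (use assms in auto)
  obtain U where U: "U \<in> open_subgroups K T" "antistable K \<psi> U"
    using assms(5) by (auto simp: finite_depth_def)
  have "h_top K T \<psi> = ereal (ln (real (expansion U)))"
    unfolding h_top_def
  proof (rule antisym)
    show "(SUP V\<in>open_subgroups K T. ereal (H_top K \<psi> V)) \<le> ereal (ln (real (expansion U)))"
    proof (rule SUP_least)
      fix V assume V: "V \<in> open_subgroups K T"
      show "ereal (H_top K \<psi> V) \<le> ereal (ln (real (expansion U)))"
        using expansion_le_antistable[OF U V] expansion_pos[OF V]
        by (simp add: H_top_eq_ln_expansion[OF V])
    qed
    show "ereal (ln (real (expansion U))) \<le> (SUP V\<in>open_subgroups K T. ereal (H_top K \<psi> V))"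
      using U(1) by (intro SUP_upper2[OF U(1)]) (simp add: H_top_eq_ln_expansion)
  qed
  then show ?thesis by (simp add: depth_eq_expansion[OF U])
qed

end
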